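(* Let $a\in\mathbb{N}$ and let $M$ be a strongly chromatic-choosable graph with $\chi(M) \geq a + 1$. Then $$f_a(M) = \bigl(P_\ell(M, \chi_\ell(M) + a - 1)\bigr)^a.$$
   Context: All graphs are finite, simple and nonempty; $\mathbb{N}=\{1,2,\dots\}$. A list assignment $L$ for a graph assigns to each vertex $v$ a set $L(v)$ of colors; a proper $L$-coloring is a proper coloring $c$ with $c(v)\in L(v)$ for all $v$; $G$ is $L$-colorable if one exists. $L$ is a $k$-assignment if $|L(v)|=k$ for all $v$, and is constant if all lists are equal. $\chi_\ell(G)$ is the least $k$ such that $G$ is $L$-colorable for every $k$-assignment $L$. The list color function $P_\ell(G,k)$ is the minimum, over all $k$-assignments $L$ for $G$, of the number of proper $L$-colorings of $G$. A graph $G$ is strong $k$-chromatic-choosable if $\chi(G)=k$ and every $(k-1)$-assignment $L$ for which $G$ is not $L$-colorable is constant; $G$ is strongly chromatic-choosable if it is strong $\chi(G)$-chromatic-choosable. The Cartesian product $G \square H$ has vertex set $V(G)\times V(H)$, with $(u,v)$ adjacent to $(u',v')$ iff either $u=u'$ and $vv'\in E(H)$, or $v=v'$ and $uu'\in E(G)$. $K_{a,b}$ is the complete bipartite graph with parts of sizes $a$ and $b$. $f_a(G)$ denotes the smallest $b\in\mathbb{N}$ such that $\chi_\ell(G \square K_{a,b}) = \chi_\ell(G) + a$. *)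

theory Defs
  imports
    "Graph_Theory.Graph_Theory"
    "HOL-Library.FuncSet"
    "HOL-Library.Extended_Nat"
begin

text \<open>
  A finite simple graph is a \<open>pair_graph\<close>: every edge \<open>uv\<close> is represented by the two arcs
  \<open>(u, v)\<close> and \<open>(v, u)\<close>. Colors are natural numbers; since graphs and lists are finite,
  any infinite supply of colors gives the same notions.
\<close>

definition proper_coloring :: "'a pair_pre_digraph \<Rightarrow> ('a \<Rightarrow> nat) \<Rightarrow> bool" where
  "proper_coloring G c \<longleftrightarrow> (\<forall>(u, v) \<in> parcs G. c u \<noteq> c v)"

definition chromatic_number :: "'a pair_pre_digraph \<Rightarrow> nat" where
  "chromatic_number G = (LEAST k. \<exists>c \<in> pverts G \<rightarrow> {..<k}. proper_coloring G c)"

text \<open>Colorings are extensional functions on the vertex set, so that they can be counted.\<close>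

definition list_colorings :: "'a pair_pre_digraph \<Rightarrow> ('a \<Rightarrow> nat set) \<Rightarrow> ('a \<Rightarrow> nat) set" where
  "list_colorings G L = {c \<in> Pi\<^sub>E (pverts G) L. proper_coloring G c}"

definition list_colorable :: "'a pair_pre_digraph \<Rightarrow> ('a \<Rightarrow> nat set) \<Rightarrow> bool" where
  "list_colorable G L \<longleftrightarrow> list_colorings G L \<noteq> {}"

text \<open>Finiteness is required explicitly because \<open>card\<close> is \<open>0\<close> on infinite sets.\<close>

definition k_assignment :: "nat \<Rightarrow> 'a pair_pre_digraph \<Rightarrow> ('a \<Rightarrow> nat set) \<Rightarrow> bool" where
  "k_assignment k G L \<longleftrightarrow> (\<forall>v \<in> pverts G. finite (L v) \<and> card (L v) = k)"

definition constant_assignment :: "'a pair_pre_digraph \<Rightarrow> ('a \<Rightarrow> nat set) \<Rightarrow> bool" where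
  "constant_assignment G L \<longleftrightarrow> (\<forall>u \<in> pverts G. \<forall>v \<in> pverts G. L u = L v)"

definition list_chromatic_number :: "'a pair_pre_digraph \<Rightarrow> nat" where
  "list_chromatic_number G = (LEAST k. \<forall>L. k_assignment k G L \<longrightarrow> list_colorable G L)"

definition list_color_function :: "'a pair_pre_digraph \<Rightarrow> nat \<Rightarrow> nat" where
  "list_color_function G k = (LEAST n. \<exists>L. k_assignment k G L \<and> n = card (list_colorings G L))"

definition strong_k_chromatic_choosable :: "nat \<Rightarrow> 'a pair_pre_digraph \<Rightarrow> bool" where
  "strong_k_chromatic_choosable k G \<longleftrightarrow>
     chromatic_number G = k \<and>
     (\<forall>L. k_assignment (k - 1) G L \<longrightarrow> \<not> list_colorable G L \<longrightarrow> constant_assignment G L)"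

definition strongly_chromatic_choosable :: "'a pair_pre_digraph \<Rightarrow> bool" where
  "strongly_chromatic_choosable G \<longleftrightarrow> strong_k_chromatic_choosable (chromatic_number G) G"

definition cartesian_product ::
    "'a pair_pre_digraph \<Rightarrow> 'b pair_pre_digraph \<Rightarrow> ('a \<times> 'b) pair_pre_digraph" (infixl \<open>\<box>\<close> 70) where
  "G \<box> H = \<lparr> pverts = pverts G \<times> pverts H,
             parcs = {((u, v), (u', v')).
                (u = u' \<and> u \<in> pverts G \<and> (v, v') \<in> parcs H) \<or>
                (v = v' \<and> v \<in> pverts H \<and> (u, u') \<in> parcs G)} \<rparr>"

definition complete_bipartite_graph :: "nat \<Rightarrow> nat \<Rightarrow> (nat + nat) pair_pre_digraph" where
  "complete_bipartite_graph a b =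
     \<lparr> pverts = Inl ` {..<a} \<union> Inr ` {..<b},
       parcs = Inl ` {..<a} \<times> Inr ` {..<b} \<union> Inr ` {..<b} \<times> Inl ` {..<a} \<rparr>"

text \<open>
  The infimum in \<^typ>\<open>enat\<close> of a nonempty set of naturals is its minimum, and it is \<open>\<infinity>\<close> for the
  empty set. Hence an equation \<open>f_bip a G = enat n\<close> includes that an admissible \<open>b\<close> exists.
\<close>

definition f_bip :: "nat \<Rightarrow> 'a pair_pre_digraph \<Rightarrow> enat" where
  "f_bip a G = Inf {enat b | b. b \<ge> 1 \<and>
     list_chromatic_number (G \<box> complete_bipartite_graph a b) = list_chromatic_number G + a}"


lemma complete_bipartite_graph_K:
  "complete_bipartite_digraph a b (with_proj (complete_bipartite_graph a b))"
proof -
  let ?U = "Inl ` {..<a} :: (nat + nat) set" and ?V = "Inr ` {..<b} :: (nat + nat) set"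
  have "?U \<inter> ?V = {}" "card ?U = a" "card ?V = b"
    by (auto simp: card_image)
  then show ?thesis
    unfolding complete_bipartite_digraph_pair_def complete_bipartite_graph_def
    by (intro conjI exI[of _ ?U] exI[of _ ?V]) simp_all
qed

lemma pair_graph_complete_bipartite_graph: "pair_graph (complete_bipartite_graph a b)"
  using complete_bipartite_graph_K by (rule pair_graphI_complete_bipartite)

lemma pair_graph_cartesian_product:
  assumes "pair_graph G" "pair_graph H"
  shows "pair_graph (G \<box> H)"
proof -
  interpret G: pair_graph G by fact
  interpret H: pair_graph H by fact
  have sub: "parcs (G \<box> H) \<subseteq> pverts (G \<box> H) \<times> pverts (G \<box> H)"
    by (auto simp: cartesian_product_def dest: G.wellformed' H.wellformed')
  have fin: "finite (pverts (G \<box> H))"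
    by (simp add: cartesian_product_def)
  have "sym (parcs G)" "sym (parcs H)"
    using G.pair_sym_arcs H.pair_sym_arcs by (simp_all add: symmetric_def)
  then have "sym (parcs (G \<box> H))"
    by (auto simp: cartesian_product_def sym_def)
  moreover have "fst e \<noteq> snd e" if "e \<in> parcs (G \<box> H)" for e
    using that by (auto simp: cartesian_product_def dest: G.pair_no_loops H.pair_no_loops)
  ultimately show ?thesis
    using sub fin finite_subset[OF sub]
    by unfold_locales (auto simp: symmetric_def)
qed

lemma list_colorable_if_card_le:
  assumes "pair_graph G" "\<And>v. v \<in> pverts G \<Longrightarrow> finite (L v) \<and> card (pverts G) \<le> card (L v)"
  shows "list_colorable G L"
proof -
  interpret pair_graph G by fact
  have "\<exists>c. (\<forall>v \<in> W. c v \<in> L v) \<and> inj_on c W" if "W \<subseteq> pverts G" for W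
  proof -
    have "finite W" using that pair_finite_verts by (rule finite_subset)
    then show ?thesis using that
    proof (induction W)
      case empty then show ?case by simp
    next
      case (insert w W)
      then obtain c where c: "\<forall>v \<in> W. c v \<in> L v" "inj_on c W" by auto
      have "card (c ` W) \<le> card W" using insert by (simp add: card_image_le)
      also have "card W < card (pverts G)"
        using insert pair_finite_verts by (intro psubset_card_mono) auto
      also have "\<dots> \<le> card (L w)" using insert assms(2) by blast
      finally have "\<not> L w \<subseteq> c ` W"
        using insert by (metis card_mono finite_imageI leD)
      then obtain x where "x \<in> L w" "x \<notin> c ` W" by blast
      then have "(\<forall>v \<in> insert w W. (c(w := x)) v \<in> L v) \<and> inj_on (c(w := x)) (insert w W)"
        using c insert.hyps by (auto simp: inj_on_def)
      then show ?case by blast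
    qed
  qed
  from this[OF subset_refl] obtain c
    where c: "\<forall>v \<in> pverts G. c v \<in> L v" "inj_on c (pverts G)" by blast
  have "restrict c (pverts G) u \<noteq> restrict c (pverts G) v" if "(u, v) \<in> parcs G" for u v
    using that inj_onD[OF c(2)] pair_no_loops[OF that] wellformed'[OF that] by auto
  then have "proper_coloring G (restrict c (pverts G))"
    unfolding proper_coloring_def by blast
  then have "restrict c (pverts G) \<in> list_colorings G L"
    using c(1) by (simp add: list_colorings_def)
  then show ?thesis by (auto simp: list_colorable_def)
qed

lemma chromatic_number_attained:
  assumes "pair_graph G"
  shows "\<exists>c \<in> pverts G \<rightarrow> {..<chromatic_number G}. proper_coloring G c"
proof -
  have "list_colorable G (\<lambda>_. {..<card (pverts G)})"
    using assms by (rule list_colorable_if_card_le) auto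
  then have "\<exists>c \<in> pverts G \<rightarrow> {..<card (pverts G)}. proper_coloring G c"
    by (auto simp: list_colorable_def list_colorings_def PiE_def)
  then show ?thesis unfolding chromatic_number_def by (rule LeastI)
qed

lemma list_colorable_list_chromatic_number:
  assumes "pair_graph G" "k_assignment (list_chromatic_number G) G L"
  shows "list_colorable G L"
proof -
  have "\<forall>L. k_assignment (card (pverts G)) G L \<longrightarrow> list_colorable G L"
    using assms(1) by (auto simp: k_assignment_def intro!: list_colorable_if_card_le)
  then have "\<forall>L. k_assignment (list_chromatic_number G) G L \<longrightarrow> list_colorable G L"
    unfolding list_chromatic_number_def by (rule LeastI)
  then show ?thesis using assms(2) by blast
qed

lemma list_color_function_attained:
  "\<exists>L. k_assignment k G L \<and> list_color_function G k = card (list_colorings G L)"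
proof -
  have "k_assignment k G (\<lambda>_. {..<k})" by (simp add: k_assignment_def)
  then have "\<exists>n L. k_assignment k G L \<and> n = card (list_colorings G L)" by blast
  then show ?thesis unfolding list_color_function_def by (rule LeastI_ex)
qed

end

theory Submission
  imports Defs
begin

text \<open>
  Write \<open>k = \<chi>(M) = \<chi>\<^sub>\<ell>(M)\<close>, call the copies of \<open>M\<close> over the part of size \<open>a\<close> left copies and
  the others right copies. Colouring the left copies first removes at most \<open>a\<close> colours from each
  list of a right copy, so \<open>\<chi>\<^sub>\<ell>(M \<box> K\<^sub>a\<^sub>,\<^sub>b) \<le> k + a\<close>, and everything is about \<open>(k + a - 1)\<close>-assignments.
  A tuple of colourings of the left copies fails to extend to a right copy only if it leaves that
  copy with a constant list \<open>C\<close> of size \<open>k - 1\<close>.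

  If \<open>b \<ge> P\<^sub>\<ell>(M, k + a - 1)\<^sup>a\<close>, give the left copies colour-disjoint versions of a minimising assignment
  and spend one right copy on blocking each tuple.

  Conversely, suppose that every tuple is blocked. Then the lists over a vertex in
  distinct left copies are disjoint, as otherwise some tuple uses one colour twice at that vertex
  and blocks nothing. Hence \<open>C\<close> determines the tuple blocked by a right copy. If a right copy had
  two possible residual lists \<open>C \<noteq> C'\<close>, a colour of \<open>C' - C\<close> would be used at every vertex by one of
  the \<open>a\<close> left colourings, which covers \<open>M\<close> by \<open>a < k\<close> independent sets. So each right copy blocks
  at most one of the at least \<open>P\<^sub>\<ell>(M, k + a - 1)\<^sup>a\<close> tuples.
\<close>

section \<open>Proper colourings, list colourings and chromatic numbers\<close>

lemma proper_coloringI: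
  "(\<And>u v. (u, v) \<in> parcs G \<Longrightarrow> c u \<noteq> c v) \<Longrightarrow> proper_coloring G c"
  by (auto simp: proper_coloring_def)

lemma proper_coloringD:
  "proper_coloring G c \<Longrightarrow> (u, v) \<in> parcs G \<Longrightarrow> c u \<noteq> c v"
  by (auto simp: proper_coloring_def)

lemma proper_coloring_restrict:
  assumes "pair_graph G"
  shows "proper_coloring G (restrict c (pverts G)) \<longleftrightarrow> proper_coloring G c"
proof -
  interpret pair_graph G by fact
  have "restrict c (pverts G) u = c u" "restrict c (pverts G) v = c v" if "(u, v) \<in> parcs G" for u v
    using wellformed'[OF that] by auto
  then show ?thesis
    by (metis proper_coloringI proper_coloringD)
qed

lemma list_colorableI:
  assumes "pair_graph G" "proper_coloring G c" "\<And>v. v \<in> pverts G \<Longrightarrow> c v \<in> L v"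
  shows "list_colorable G L"
  using assms proper_coloring_restrict[OF assms(1), of c]
  by (auto simp: list_colorable_def list_colorings_def intro!: exI[of _ "restrict c (pverts G)"])

lemma list_colorable_mono:
  assumes "list_colorable G L'" "\<And>v. v \<in> pverts G \<Longrightarrow> L' v \<subseteq> L v"
  shows "list_colorable G L"
  using assms by (fastforce simp: list_colorable_def list_colorings_def PiE_iff)

text \<open>Colours are relabelled along a bijection of \<open>C\<close> with
  \<open>{..<card C}\<close>, since \<open>chromatic_number\<close> admits only initial segments of
  the naturals.\<close>

lemma chromatic_number_le_card:
  assumes "proper_coloring G c" "c \<in> pverts G \<rightarrow> C" "finite C" "pair_graph G"
  shows "chromatic_number G \<le> card C"
proof -
  interpret pair_graph G by fact
  obtain h where h: "bij_betw h C {..<card C}"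
    using ex_bij_betw_finite_nat[OF assms(3)] by (auto simp: atLeast0LessThan)
  have "h \<circ> c \<in> pverts G \<rightarrow> {..<card C}"
    using assms(2) bij_betw_apply[OF h] by (simp add: Pi_iff)
  moreover have "proper_coloring G (h \<circ> c)"
  proof (rule proper_coloringI)
    fix u v assume uv: "(u, v) \<in> parcs G"
    then have "c u \<in> C" "c v \<in> C" "c u \<noteq> c v"
      using assms(1,2) wellformed'[OF uv] by (auto dest: proper_coloringD)
    then show "(h \<circ> c) u \<noteq> (h \<circ> c) v"
      using h by (auto simp: bij_betw_def dest: inj_onD)
  qed
  ultimately show ?thesis
    unfolding chromatic_number_def by (intro Least_le) blast
qed

lemma chromatic_number_le_if_list_colorable:
  assumes "pair_graph G" "finite C" "list_colorable G (\<lambda>_. C)"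
  shows "chromatic_number G \<le> card C"
proof -
  obtain c where "c \<in> pverts G \<rightarrow>\<^sub>E C" "proper_coloring G c"
    using assms(3) by (auto simp: list_colorable_def list_colorings_def)
  then show ?thesis
    using assms by (intro chromatic_number_le_card) (auto simp: PiE_def)
qed

text \<open>A \<open>LEAST\<close> says nothing about larger \<open>m\<close> by itself. Here each
  list is cut down to a subset of the least sufficient size, and a colouring from the subsets is a
  colouring from the lists.\<close>

lemma list_chromatic_number_le_iff:
  assumes "pair_graph G"
  shows "list_chromatic_number G \<le> m \<longleftrightarrow> (\<forall>L. k_assignment m G L \<longrightarrow> list_colorable G L)"
proof
  assume le: "list_chromatic_number G \<le> m"
  show "\<forall>L. k_assignment m G L \<longrightarrow> list_colorable G L"
  proof (intro allI impI)
    fix L assume L: "k_assignment m G L"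
    have "\<forall>v\<in>pverts G. \<exists>T\<subseteq>L v. finite T \<and> card T = list_chromatic_number G"
    proof
      fix v assume "v \<in> pverts G"
      then have "list_chromatic_number G \<le> card (L v)"
        using L le by (simp add: k_assignment_def)
      then show "\<exists>T\<subseteq>L v. finite T \<and> card T = list_chromatic_number G"
        by (meson obtain_subset_with_card_n)
    qed
    then obtain S where S: "\<And>v. v \<in> pverts G \<Longrightarrow>
        S v \<subseteq> L v \<and> finite (S v) \<and> card (S v) = list_chromatic_number G"
      by metis
    then have "list_colorable G S"
      using list_colorable_list_chromatic_number[OF assms] by (simp add: k_assignment_def)
    then show "list_colorable G L"
      using S by (blast intro: list_colorable_mono)
  qed
next
  assume "\<forall>L. k_assignment m G L \<longrightarrow> list_colorable G L"
  then show "list_chromatic_number G \<le> m"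
    unfolding list_chromatic_number_def by (rule Least_le)
qed

section \<open>Counting list colourings\<close>

lemma finite_list_colorings:
  assumes "pair_graph G" "k_assignment m G L"
  shows "finite (list_colorings G L)"
proof -
  interpret pair_graph G by fact
  have "finite (Pi\<^sub>E (pverts G) L)"
    using assms(2) by (intro finite_PiE) (auto simp: k_assignment_def)
  then show ?thesis
    by (rule rev_finite_subset) (auto simp: list_colorings_def)
qed

lemma list_color_function_le:
  assumes "k_assignment m G L"
  shows "list_color_function G m \<le> card (list_colorings G L)"
  unfolding list_color_function_def using assms by (intro Least_le) blast

text \<open>Injective renaming of colours is a bijection between colourings. It supplies
  colour-disjoint copies of a minimising assignment with the same count.\<close>

lemma card_list_colorings_image:
  assumes "pair_graph G" "inj f"
  shows "card (list_colorings G (\<lambda>v. f ` L v)) = card (list_colorings G L)"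
proof -
  interpret pair_graph G by fact
  let ?F = "\<lambda>c. \<lambda>v\<in>pverts G. f (c v)"
  have "inj_on ?F (list_colorings G L)"
  proof (rule inj_onI)
    fix c d assume c: "c \<in> list_colorings G L" and d: "d \<in> list_colorings G L" and eq: "?F c = ?F d"
    have "c v = d v" if "v \<in> pverts G" for v
      using fun_cong[OF eq, of v] that \<open>inj f\<close> by (simp add: inj_eq)
    then show "c = d"
      using c d by (auto simp: list_colorings_def intro: PiE_ext)
  qed
  moreover have "?F ` list_colorings G L = list_colorings G (\<lambda>v. f ` L v)"
  proof
    show "?F ` list_colorings G L \<subseteq> list_colorings G (\<lambda>v. f ` L v)"
    proof
      fix d assume "d \<in> ?F ` list_colorings G L"
      then obtain c where c: "c \<in> Pi\<^sub>E (pverts G) L" "proper_coloring G c" and d: "d = ?F c"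
        by (auto simp: list_colorings_def)
      have "proper_coloring G (\<lambda>v. f (c v))"
        using c(2) \<open>inj f\<close> by (auto simp: proper_coloring_def inj_eq)
      then show "d \<in> list_colorings G (\<lambda>v. f ` L v)"
        using c(1) unfolding d list_colorings_def
        by (auto simp: proper_coloring_restrict[OF assms(1)])
    qed
    show "list_colorings G (\<lambda>v. f ` L v) \<subseteq> ?F ` list_colorings G L"
    proof
      fix d assume d: "d \<in> list_colorings G (\<lambda>v. f ` L v)"
      define c where "c = (\<lambda>v\<in>pverts G. inv f (d v))"
      have dL: "d v \<in> f ` L v" if "v \<in> pverts G" for v
        using d that by (auto simp: list_colorings_def)
      have cL: "c v \<in> L v" "f (c v) = d v" if "v \<in> pverts G" for v
        using dL[OF that] that \<open>inj f\<close> by (auto simp: c_def)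
      have "c u \<noteq> c v" if "(u, v) \<in> parcs G" for u v
      proof -
        have "d u \<noteq> d v"
          using d that by (auto simp: list_colorings_def proper_coloring_def)
        then show ?thesis
          using cL(2) wellformed'[OF that] by metis
      qed
      then have "proper_coloring G c"
        by (rule proper_coloringI)
      moreover have "c \<in> Pi\<^sub>E (pverts G) L"
        using cL(1) by (auto simp: c_def)
      ultimately have "c \<in> list_colorings G L"
        by (simp add: list_colorings_def)
      moreover have "?F c = d"
        using d cL(2) by (intro ext) (auto simp: list_colorings_def PiE_def extensional_def)
      ultimately show "d \<in> ?F ` list_colorings G L" by blast
    qed
  qed
  ultimately show ?thesis
    using card_image by fastforce
qed

section \<open>Reduction of the product to tuples of colourings of the factor\<close>

lemma k_assignment_product_bipartite_iff:
  "k_assignment m (G \<box> complete_bipartite_graph a b) L \<longleftrightarrow>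
     (\<forall>i<a. k_assignment m G (\<lambda>v. L (v, Inl i))) \<and> (\<forall>j<b. k_assignment m G (\<lambda>v. L (v, Inr j)))"
  by (auto simp: k_assignment_def cartesian_product_def complete_bipartite_graph_def)

text \<open>Copies of \<open>G\<close> over the same part are not joined by arcs. So the left copies
  are coloured independently, and then each right copy is a separate list colouring problem in which
  \<open>v\<close> loses just the colours \<open>c i v\<close>.\<close>

lemma list_colorable_product_bipartite_iff:
  assumes "pair_graph G"
  shows "list_colorable (G \<box> complete_bipartite_graph a b) L \<longleftrightarrow>
    (\<exists>c \<in> (\<Pi>\<^sub>E i\<in>{..<a}. list_colorings G (\<lambda>v. L (v, Inl i))).
       \<forall>j<b. list_colorable G (\<lambda>v. L (v, Inr j) - (\<lambda>i. c i v) ` {..<a}))"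
    (is "list_colorable ?H L \<longleftrightarrow> ?R")
proof
  interpret pair_graph G by fact
  assume "list_colorable ?H L"
  then obtain f where "f \<in> Pi\<^sub>E (pverts ?H) L" and proper: "proper_coloring ?H f"
    by (auto simp: list_colorable_def list_colorings_def)
  then have fL: "f x \<in> L x" if "x \<in> pverts ?H" for x
    using that by blast
  have f: "f x \<noteq> f y" if "(x, y) \<in> parcs ?H" for x y
    using proper that by (rule proper_coloringD)
  define c where "c = (\<lambda>i\<in>{..<a}. \<lambda>v\<in>pverts G. f (v, Inl i))"
  have "c i \<in> list_colorings G (\<lambda>v. L (v, Inl i))" if "i < a" for i
  proof -
    have "proper_coloring G (\<lambda>v. f (v, Inl i))"
      unfolding proper_coloring_def using that
      by (auto intro!: f simp: cartesian_product_def complete_bipartite_graph_def)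
    then show ?thesis
      using that fL proper_coloring_restrict[OF assms]
      by (auto simp: list_colorings_def c_def cartesian_product_def complete_bipartite_graph_def)
  qed
  then have "c \<in> (\<Pi>\<^sub>E i\<in>{..<a}. list_colorings G (\<lambda>v. L (v, Inl i)))"
    by (auto simp: c_def)
  moreover have "list_colorable G (\<lambda>v. L (v, Inr j) - (\<lambda>i. c i v) ` {..<a})" if "j < b" for j
  proof (rule list_colorableI[OF assms])
    show "proper_coloring G (\<lambda>v. f (v, Inr j))"
      unfolding proper_coloring_def using that
      by (auto intro!: f simp: cartesian_product_def complete_bipartite_graph_def)
    fix v assume v: "v \<in> pverts G"
    have "f (v, Inr j) \<in> L (v, Inr j)"
      using v that by (intro fL) (auto simp: cartesian_product_def complete_bipartite_graph_def)
    moreover have "f (v, Inr j) \<noteq> f (v, Inl i)" if "i < a" for i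
      using v that \<open>j < b\<close> by (intro f) (auto simp: cartesian_product_def complete_bipartite_graph_def)
    ultimately show "f (v, Inr j) \<in> L (v, Inr j) - (\<lambda>i. c i v) ` {..<a}"
      using v by (auto simp: c_def)
  qed
  ultimately show ?R by blast
next
  interpret pair_graph G by fact
  assume ?R
  then obtain c where c: "c \<in> (\<Pi>\<^sub>E i\<in>{..<a}. list_colorings G (\<lambda>v. L (v, Inl i)))"
    and "\<forall>j<b. list_colorable G (\<lambda>v. L (v, Inr j) - (\<lambda>i. c i v) ` {..<a})"
    by blast
  then have "\<forall>j<b. \<exists>d. d \<in> list_colorings G (\<lambda>v. L (v, Inr j) - (\<lambda>i. c i v) ` {..<a})"
    by (auto simp: list_colorable_def)
  then obtain d where d: "\<And>j. j < b \<Longrightarrow>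
      d j \<in> list_colorings G (\<lambda>v. L (v, Inr j) - (\<lambda>i. c i v) ` {..<a})"
    by metis
  define f where "f = (\<lambda>(v, x). case x of Inl i \<Rightarrow> c i v | Inr j \<Rightarrow> d j v)"
  have c_L: "c i v \<in> L (v, Inl i)" if "i < a" "v \<in> pverts G" for i v
    using c that by (auto simp: list_colorings_def PiE_iff)
  have c_proper: "c i u \<noteq> c i v" if "i < a" "(u, v) \<in> parcs G" for i u v
    using c that by (fastforce simp: list_colorings_def proper_coloring_def PiE_iff)
  have d_L: "d j v \<in> L (v, Inr j)" "\<And>i. i < a \<Longrightarrow> d j v \<noteq> c i v" if "j < b" "v \<in> pverts G" for j v
    using d[OF that(1)] that(2) by (auto simp: list_colorings_def PiE_iff)
  have d_proper: "d j u \<noteq> d j v" if "j < b" "(u, v) \<in> parcs G" for j u v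
    using d[OF that(1)] that(2) by (auto simp: list_colorings_def proper_coloring_def)
  show "list_colorable ?H L"
  proof (rule list_colorableI)
    show "pair_graph ?H"
      using assms by (intro pair_graph_cartesian_product pair_graph_complete_bipartite_graph)
    show "proper_coloring ?H f"
      using c_proper d_proper d_L(2) not_sym[OF d_L(2)]
      by (auto simp: proper_coloring_def f_def cartesian_product_def complete_bipartite_graph_def)
    show "f x \<in> L x" if "x \<in> pverts ?H" for x
      using that c_L d_L
      by (auto simp: f_def cartesian_product_def complete_bipartite_graph_def)
  qed
qed

section \<open>Colourability of a strongly chromatic-choosable graph\<close>

locale strong_chromatic_choosable = pair_graph M for M :: "'a pair_pre_digraph" +
  fixes k :: nat
  assumes strong: "strong_k_chromatic_choosable k M" and k_ge_2: "2 \<le> k"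
begin

lemma pair_graph_M: "pair_graph M"
  by unfold_locales

lemma chromatic_number_eq: "chromatic_number M = k"
  using strong by (simp add: strong_k_chromatic_choosable_def)

lemma not_list_colorable_constant:
  assumes "finite C" "card C < k"
  shows "\<not> list_colorable M (\<lambda>_. C)"
  using chromatic_number_le_if_list_colorable[OF pair_graph_M assms(1)] assms(2) chromatic_number_eq
  by auto

text \<open>With at most one vertex there are no arcs, so one colour would suffice, against
  \<open>2 \<le> k\<close>. The exchange argument below compares \<open>w\<close> with this second
  vertex.\<close>

lemma exists_other_vertex: "\<exists>u\<in>pverts M. u \<noteq> w"
proof (rule ccontr)
  assume "\<not> ?thesis"
  then have sub: "pverts M \<subseteq> {w}" by blast
  have "proper_coloring M (\<lambda>_. 0)"
  proof (rule proper_coloringI)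
    fix u v assume uv: "(u, v) \<in> parcs M"
    then show "(0::nat) \<noteq> 0"
      using sub wellformed'[OF uv] pair_no_loops[OF uv] by auto
  qed
  then have "list_colorable M (\<lambda>_. {0})"
    by (intro list_colorableI pair_graph_M) auto
  then show False
    using not_list_colorable_constant[of "{0}"] k_ge_2 by simp
qed

text \<open>
  If some list \<open>L w\<close> had a colour beyond the constant \<open>(k - 1)\<close>-subassignment, exchanging it in at
  \<open>w\<close> would give an uncolourable assignment that is not constant.
\<close>

lemma not_list_colorable_imp_constant:
  assumes L: "\<And>v. v \<in> pverts M \<Longrightarrow> finite (L v) \<and> k - 1 \<le> card (L v)"
    and not_col: "\<not> list_colorable M L"
  obtains C where "finite C" "card C = k - 1" "\<And>v. v \<in> pverts M \<Longrightarrow> L v = C"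
proof -
  have const: "S u = S v"
    if "\<And>v. v \<in> pverts M \<Longrightarrow> S v \<subseteq> L v \<and> card (S v) = k - 1" "u \<in> pverts M" "v \<in> pverts M" for S u v
  proof -
    have "\<not> list_colorable M S"
      using that(1) not_col list_colorable_mono by blast
    moreover have "k_assignment (k - 1) M S"
      using that(1) L finite_subset by (fastforce simp: k_assignment_def)
    ultimately show ?thesis
      using strong that(2,3)
      by (auto simp: strong_k_chromatic_choosable_def constant_assignment_def)
  qed
  have "\<forall>v\<in>pverts M. \<exists>T\<subseteq>L v. card T = k - 1"
    using L by (meson obtain_subset_with_card_n)
  then obtain S where S: "\<And>v. v \<in> pverts M \<Longrightarrow> S v \<subseteq> L v \<and> card (S v) = k - 1"
    by metis
  have eq: "L w = S w" if w: "w \<in> pverts M" for w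
  proof (rule ccontr)
    assume "L w \<noteq> S w"
    then obtain x where x: "x \<in> L w" "x \<notin> S w" using S[OF w] by blast
    have fin: "finite (S w)" using S[OF w] L[OF w] finite_subset by blast
    have "S w \<noteq> {}" using S[OF w] k_ge_2 by auto
    then obtain y where y: "y \<in> S w" by blast
    obtain u where u: "u \<in> pverts M" "u \<noteq> w" using exists_other_vertex by blast
    let ?S = "S(w := insert x (S w - {y}))"
    have "card (insert x (S w - {y})) = card (S w)"
      using x y fin card_Suc_Diff1[of "S w" y] by simp
    then have "?S u = ?S w"
      using S x w u by (intro const) auto
    moreover have "S u = S w"
      using S w u by (intro const)
    ultimately show False
      using x u by auto
  qed
  obtain u where u: "u \<in> pverts M" using exists_other_vertex by blast
  show ?thesis
  proof (rule that[of "S u"])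
    show "finite (S u)" using L[OF u] eq[OF u] by simp
    show "card (S u) = k - 1" using S[OF u] by simp
    show "L v = S u" if "v \<in> pverts M" for v
      using eq[OF that] const[of S v u] S that u by simp
  qed
qed

text \<open>Uncolourability would make every list equal to one set of size \<open>k - 1\<close>,
  which is too small.\<close>

lemma list_colorable_if_k_le:
  assumes "\<And>v. v \<in> pverts M \<Longrightarrow> finite (L v) \<and> k \<le> card (L v)"
  shows "list_colorable M L"
proof (rule ccontr)
  assume "\<not> list_colorable M L"
  moreover have "finite (L v) \<and> k - 1 \<le> card (L v)" if "v \<in> pverts M" for v
    using assms[OF that] by auto
  ultimately obtain C where "card C = k - 1" "\<And>v. v \<in> pverts M \<Longrightarrow> L v = C"
    using not_list_colorable_imp_constant by metis
  moreover obtain u where "u \<in> pverts M" using exists_other_vertex by blast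
  ultimately show False
    using assms[of u] k_ge_2 by auto
qed

lemma list_chromatic_number_eq: "list_chromatic_number M = k"
proof (rule antisym)
  show "list_chromatic_number M \<le> k"
    unfolding list_chromatic_number_le_iff[OF pair_graph_M]
    by (auto simp: k_assignment_def intro: list_colorable_if_k_le)
  have "list_colorable M (\<lambda>_. {..<list_chromatic_number M})"
    by (intro list_colorable_list_chromatic_number[OF pair_graph_M]) (simp add: k_assignment_def)
  then show "k \<le> list_chromatic_number M"
    using not_list_colorable_constant[of "{..<list_chromatic_number M}"] by (auto simp: not_less[symmetric])
qed

lemma list_color_function_pos:
  assumes "k \<le> m"
  shows "0 < list_color_function M m"
proof -
  obtain L where L: "k_assignment m M L" "list_color_function M m = card (list_colorings M L)"
    using list_color_function_attained by blast
  have "list_colorable M L"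
    using L(1) assms by (intro list_colorable_if_k_le) (auto simp: k_assignment_def)
  then show ?thesis
    using L finite_list_colorings[OF pair_graph_M L(1)]
    by (simp add: list_colorable_def card_gt_0_iff)
qed

text \<open>Deleting \<open>x\<close> from all lists leaves at least \<open>k\<close> colours in
  each, so \<open>M\<close> can be coloured without \<open>x\<close>; recolouring \<open>v\<close>
  with \<open>x\<close> then causes no conflict.\<close>

lemma list_coloring_with_prescribed_color:
  assumes "k_assignment m M L" "k < m" "v \<in> pverts M" "x \<in> L v"
  obtains c where "c \<in> list_colorings M L" "c v = x"
proof -
  have "list_colorable M (\<lambda>u. L u - {x})"
    using assms(1,2) by (intro list_colorable_if_k_le) (auto simp: k_assignment_def card_Diff_singleton_if)
  then obtain c where c: "c \<in> list_colorings M (\<lambda>u. L u - {x})"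
    by (auto simp: list_colorable_def)
  then have cu: "c u \<in> L u" "c u \<noteq> x" if "u \<in> pverts M" for u
    using that by (auto simp: list_colorings_def PiE_iff)
  have "proper_coloring M c"
    using c by (simp add: list_colorings_def)
  have "proper_coloring M (c(v := x))"
  proof (rule proper_coloringI)
    fix u w assume uw: "(u, w) \<in> parcs M"
    then show "(c(v := x)) u \<noteq> (c(v := x)) w"
      using proper_coloringD[OF \<open>proper_coloring M c\<close> uw] cu(2) wellformed'[OF uw]
        pair_no_loops[OF uw]
      by auto
  qed
  moreover have "c(v := x) \<in> Pi\<^sub>E (pverts M) L"
    using c cu(1) assms(3,4) by (auto simp: list_colorings_def PiE_iff extensional_def)
  ultimately have "c(v := x) \<in> list_colorings M L"
    by (simp add: list_colorings_def)
  then show ?thesis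
    using that by simp
qed

section \<open>Upper bound for the product\<close>

lemma list_chromatic_number_product_le:
  "list_chromatic_number (M \<box> complete_bipartite_graph a b) \<le> k + a"
proof -
  have "list_colorable (M \<box> complete_bipartite_graph a b) L"
    if L: "k_assignment (k + a) (M \<box> complete_bipartite_graph a b) L" for L
  proof -
    have "\<forall>i<a. \<exists>c. c \<in> list_colorings M (\<lambda>v. L (v, Inl i))"
    proof (intro allI impI)
      fix i assume "i < a"
      then have "k_assignment (k + a) M (\<lambda>v. L (v, Inl i))"
        using L by (simp add: k_assignment_product_bipartite_iff)
      then have "list_colorable M (\<lambda>v. L (v, Inl i))"
        by (intro list_colorable_if_k_le) (simp add: k_assignment_def)
      then show "\<exists>c. c \<in> list_colorings M (\<lambda>v. L (v, Inl i))"
        by (auto simp: list_colorable_def)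
    qed
    then obtain c where c: "\<And>i. i < a \<Longrightarrow> c i \<in> list_colorings M (\<lambda>v. L (v, Inl i))"
      by metis
    have "list_colorable M (\<lambda>v. L (v, Inr j) - (\<lambda>i. restrict c {..<a} i v) ` {..<a})"
      if "j < b" for j
    proof (rule list_colorable_if_k_le)
      fix v assume "v \<in> pverts M"
      moreover have "k_assignment (k + a) M (\<lambda>v. L (v, Inr j))"
        using L that by (simp add: k_assignment_product_bipartite_iff)
      ultimately have fin: "finite (L (v, Inr j))" and card: "card (L (v, Inr j)) = k + a"
        by (auto simp: k_assignment_def)
      have "card ((\<lambda>i. restrict c {..<a} i v) ` {..<a}) \<le> a"
        using card_image_le[of "{..<a}"] by simp
      then show "finite (L (v, Inr j) - (\<lambda>i. restrict c {..<a} i v) ` {..<a}) \<and>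
          k \<le> card (L (v, Inr j) - (\<lambda>i. restrict c {..<a} i v) ` {..<a})"
        using fin card diff_card_le_card_Diff[of "(\<lambda>i. restrict c {..<a} i v) ` {..<a}" "L (v, Inr j)"]
        by simp
    qed
    moreover have "restrict c {..<a} \<in> (\<Pi>\<^sub>E i\<in>{..<a}. list_colorings M (\<lambda>v. L (v, Inl i)))"
      using c by auto
    ultimately show ?thesis
      unfolding list_colorable_product_bipartite_iff[OF pair_graph_M] by blast
  qed
  then show ?thesis
    using list_chromatic_number_le_iff pair_graph_cartesian_product[OF pair_graph_M]
      pair_graph_complete_bipartite_graph by blast
qed

section \<open>An uncolourable assignment for large \<open>b\<close>\<close>

lemma exists_uncolorable_product_assignment:
  assumes "1 \<le> a" and b: "list_color_function M (k + a - 1) ^ a \<le> b"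
  shows "\<exists>L. k_assignment (k + a - 1) (M \<box> complete_bipartite_graph a b) L \<and>
    \<not> list_colorable (M \<box> complete_bipartite_graph a b) L"
proof -
  define P where "P = list_color_function M (k + a - 1)"
  obtain L0 where L0: "k_assignment (k + a - 1) M L0" and P: "P = card (list_colorings M L0)"
    unfolding P_def using list_color_function_attained by blast
  \<comment> \<open>The pairing tags colours: tags \<open>i < a\<close> separate the left copies,
    and tag \<open>a\<close> is kept for the residual list \<open>C\<close>.\<close>
  define f :: "nat \<Rightarrow> nat \<Rightarrow> nat" where "f i x = prod_encode (i, x)" for i x
  have f_eq: "f i x = f i' x' \<longleftrightarrow> i = i' \<and> x = x'" for i x i' x'
    by (simp add: f_def prod_encode_eq)
  have inj_f: "inj (f i)" for i
    by (simp add: inj_def f_eq)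
  define C where "C = f a ` {..<k - 1}"
  define T where "T = (\<Pi>\<^sub>E i\<in>{..<a}. list_colorings M (\<lambda>v. f i ` L0 v))"
  have C: "finite C" "card C = k - 1"
    using inj_f by (auto simp: C_def card_image inj_on_def f_eq)
  have card_T: "card T = P ^ a"
    by (simp add: T_def card_PiE card_list_colorings_image[OF pair_graph_M inj_f] P)
  have "0 < P"
    unfolding P_def using assms(1) by (intro list_color_function_pos) auto
  \<comment> \<open>\<open>card\<close> is 0 on infinite sets, so the positive value
    \<open>P ^ a\<close> yields finiteness.\<close>
  then have "finite T"
    using card_T by (metis card.infinite less_irrefl zero_less_power)
  then obtain e where e: "bij_betw e {..<P ^ a} T"
    using ex_bij_betw_nat_finite card_T by (fastforce simp: atLeast0LessThan)
  \<comment> \<open>As \<open>b\<close> may exceed \<open>P ^ a\<close>, the enumeration is repeated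
    periodically: every right copy gets a tuple, and the first \<open>P ^ a\<close> of them already
    meet all tuples.\<close>
  define t where "t j = e (j mod P ^ a)" for j
  have t_T: "t j \<in> T" for j
    using e \<open>0 < P\<close> by (auto simp: t_def bij_betw_def)
  have t_surj: "\<exists>j<b. t j = c" if c: "c \<in> T" for c
  proof -
    obtain j where "j < P ^ a" "e j = c"
      using e c by (auto simp: bij_betw_def)
    then show ?thesis
      using b by (intro exI[of _ j]) (auto simp: t_def P_def)
  qed
  \<comment> \<open>A right list is \<open>C\<close> together with the \<open>a\<close> colours that
    the tuple \<open>t j\<close> puts at \<open>v\<close>. The tags make these distinct and disjoint
    from \<open>C\<close>, so the size is \<open>(k - 1) + a\<close>.\<close>
  define L where "L = (\<lambda>(v, x). case x of Inl i \<Rightarrow> f i ` L0 v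
    | Inr j \<Rightarrow> C \<union> (\<lambda>i. t j i v) ` {..<a})"
  have L_simps: "L (v, Inl i) = f i ` L0 v" "L (v, Inr j) = C \<union> (\<lambda>i. t j i v) ` {..<a}" for v i j
    by (simp_all add: L_def)
  have "k_assignment (k + a - 1) M (\<lambda>v. L (v, Inl i))" for i
    using L0 inj_f[of i] by (auto simp: k_assignment_def L_simps card_image inj_on_subset)
  moreover have "k_assignment (k + a - 1) M (\<lambda>v. L (v, Inr j))" for j
    unfolding k_assignment_def
  proof (intro ballI conjI)
    fix v assume v: "v \<in> pverts M"
    have t_f: "\<exists>x. t j i v = f i x" if "i < a" for i
      using t_T[of j] that v by (auto simp: T_def list_colorings_def PiE_iff)
    have "inj_on (\<lambda>i. t j i v) {..<a}"
    proof (rule inj_onI)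
      fix i i' assume i: "i \<in> {..<a}" "i' \<in> {..<a}" and eq: "t j i v = t j i' v"
      obtain x x' where "t j i v = f i x" "t j i' v = f i' x'"
        using t_f i by blast
      then have "f i x = f i' x'" using eq by metis
      then show "i = i'" by (simp add: f_eq)
    qed
    moreover have "t j i v \<notin> C" if i: "i < a" for i
    proof -
      obtain x where "t j i v = f i x" using t_f i by blast
      then show ?thesis using i by (auto simp: C_def f_eq)
    qed
    then have "C \<inter> (\<lambda>i. t j i v) ` {..<a} = {}" by blast
    ultimately show "card (L (v, Inr j)) = k + a - 1"
      using C k_ge_2 by (simp add: L_simps card_Un_disjoint card_image)
    show "finite (L (v, Inr j))"
      using C by (simp add: L_simps)
  qed
  ultimately have "k_assignment (k + a - 1) (M \<box> complete_bipartite_graph a b) L"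
    by (simp add: k_assignment_product_bipartite_iff)
  moreover have "\<not> list_colorable (M \<box> complete_bipartite_graph a b) L"
  proof
    assume "list_colorable (M \<box> complete_bipartite_graph a b) L"
    then obtain c where "c \<in> T"
      and c: "\<forall>j<b. list_colorable M (\<lambda>v. L (v, Inr j) - (\<lambda>i. c i v) ` {..<a})"
      by (auto simp: list_colorable_product_bipartite_iff[OF pair_graph_M] T_def L_simps)
    obtain j where "j < b" "t j = c"
      using t_surj[OF \<open>c \<in> T\<close>] by blast
    \<comment> \<open>Deleting the colours of \<open>c = t j\<close> from the lists of copy
      \<open>j\<close> leaves subsets of \<open>C\<close>.\<close>
    then have "list_colorable M (\<lambda>_. C)"
      using c by (auto intro: list_colorable_mono simp: L_simps)
    then show False
      using C k_ge_2 not_list_colorable_constant[of C] by simp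
  qed
  ultimately show ?thesis by blast
qed

section \<open>Blocked tuples, and colourability for small \<open>b\<close>\<close>

text \<open>At least \<open>k - 1\<close> colours survive at each vertex, so uncolourability forces
  the survivors to be one set \<open>C\<close> of exactly that size. Then \<open>a\<close> colours
  of \<open>R v\<close> are lost, which requires the \<open>a\<close> left colours at
  \<open>v\<close> to be distinct and all in \<open>R v\<close>.\<close>

lemma blocked_imp_residual:
  assumes R: "k_assignment (k + a - 1) M R"
    and not_col: "\<not> list_colorable M (\<lambda>v. R v - (\<lambda>i. c i v) ` {..<a})"
  obtains C where "finite C" "card C = k - 1"
    "\<And>v. v \<in> pverts M \<Longrightarrow> R v - (\<lambda>i. c i v) ` {..<a} = C"
    "\<And>v. v \<in> pverts M \<Longrightarrow> (\<lambda>i. c i v) ` {..<a} = R v - C"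
    "\<And>v. v \<in> pverts M \<Longrightarrow> inj_on (\<lambda>i. c i v) {..<a}"
proof -
  have im: "card ((\<lambda>i. c i v) ` {..<a}) \<le> a" for v
    using card_image_le[of "{..<a}"] by simp
  have "finite (R v - (\<lambda>i. c i v) ` {..<a}) \<and> k - 1 \<le> card (R v - (\<lambda>i. c i v) ` {..<a})"
    if "v \<in> pverts M" for v
    using R im[of v] that diff_card_le_card_Diff[of "(\<lambda>i. c i v) ` {..<a}" "R v"]
    by (auto simp: k_assignment_def)
  then obtain C where C: "finite C" "card C = k - 1"
    and res: "\<And>v. v \<in> pverts M \<Longrightarrow> R v - (\<lambda>i. c i v) ` {..<a} = C"
    using not_list_colorable_imp_constant[OF _ not_col] by metis
  have main: "(\<lambda>i. c i v) ` {..<a} = R v - C \<and> inj_on (\<lambda>i. c i v) {..<a}" if v: "v \<in> pverts M" for v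
  proof -
    have Rv: "finite (R v)" "card (R v) = k + a - 1"
      using R v by (auto simp: k_assignment_def)
    have sub: "R v - C \<subseteq> (\<lambda>i. c i v) ` {..<a}" "C \<subseteq> R v"
      using res[OF v] by auto
    have card: "card (R v - C) = a"
      using Rv C sub(2) k_ge_2 by (simp add: card_Diff_subset)
    then have "(\<lambda>i. c i v) ` {..<a} = R v - C"
      using sub(1) im[of v] by (metis card_seteq finite_imageI finite_lessThan)
    then show ?thesis
      using card by (simp add: eq_card_imp_inj_on)
  qed
  show ?thesis
    using C res main by (intro that[of C]) auto
qed

lemma residual_unique:
  assumes "a < k" "finite C" "card C = card C'"
    and c: "\<And>i. i < a \<Longrightarrow> proper_coloring M (c i)"
    and C: "\<And>v. v \<in> pverts M \<Longrightarrow> (\<lambda>i. c i v) ` {..<a} = R v - C"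
    and C': "\<And>v. v \<in> pverts M \<Longrightarrow> C' \<subseteq> R v"
  shows "C = C'"
proof (rule ccontr)
  assume "C \<noteq> C'"
  then have "\<not> C' \<subseteq> C"
    using assms(3) \<open>finite C\<close> by (metis card_subset_eq)
  then obtain x where x: "x \<in> C'" "x \<notin> C" by blast
  have "\<forall>v\<in>pverts M. \<exists>i<a. c i v = x"
  proof
    fix v assume v: "v \<in> pverts M"
    then have "x \<in> (\<lambda>i. c i v) ` {..<a}"
      using C[OF v] C'[OF v] x by auto
    then show "\<exists>i<a. c i v = x" by auto
  qed
  \<comment> \<open>Choosing at each vertex an index whose colouring uses \<open>x\<close> there
    gives a colouring with \<open>a\<close> colours. It is proper: adjacent vertices with equal
    index would both receive \<open>x\<close> from one proper colouring.\<close>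
  then obtain i where i: "\<And>v. v \<in> pverts M \<Longrightarrow> i v < a \<and> c (i v) v = x"
    by metis
  have "i u \<noteq> i v" if "(u, v) \<in> parcs M" for u v
  proof
    assume "i u = i v"
    then have "c (i u) u = c (i u) v"
      using i[of u] i[of v] wellformed'[OF that] by simp
    then show False
      using c[of "i u"] i wellformed'[OF that] that by (auto simp: proper_coloring_def)
  qed
  then have "chromatic_number M \<le> card {..<a}"
    using i by (intro chromatic_number_le_card[of M i] pair_graph_M) (auto simp: proper_coloring_def)
  then show False
    using assms(1) chromatic_number_eq by simp
qed

lemma list_colorable_product_bipartite:
  assumes "1 \<le> a" "a < k" and b: "b < list_color_function M (k + a - 1) ^ a"
    and L: "k_assignment (k + a - 1) (M \<box> complete_bipartite_graph a b) L"
  shows "list_colorable (M \<box> complete_bipartite_graph a b) L"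
proof (rule ccontr)
  assume not_col: "\<not> ?thesis"
  define A where "A i v = L (v, Inl i)" for i v
  define R where "R j v = L (v, Inr j)" for j v
  define T where "T = (\<Pi>\<^sub>E i\<in>{..<a}. list_colorings M (A i))"
  have A: "k_assignment (k + a - 1) M (A i)" if "i < a" for i
    using L that unfolding A_def by (simp add: k_assignment_product_bipartite_iff)
  have R: "k_assignment (k + a - 1) M (R j)" if "j < b" for j
    using L that unfolding R_def by (simp add: k_assignment_product_bipartite_iff)
  have T_A: "c i v \<in> A i v" if "c \<in> T" "i < a" "v \<in> pverts M" for c i v
    using that by (auto simp: T_def list_colorings_def PiE_iff)
  have T_proper: "proper_coloring M (c i)" if "c \<in> T" "i < a" for c i
    using that by (auto simp: T_def list_colorings_def PiE_iff)
  have "\<forall>c\<in>T. \<exists>j<b. \<not> list_colorable M (\<lambda>v. R j v - (\<lambda>i. c i v) ` {..<a})"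
    using not_col unfolding list_colorable_product_bipartite_iff[OF pair_graph_M] T_def A_def R_def
    by blast
  \<comment> \<open>Each tuple is charged to one right copy that blocks it; the count rests on this
    charging being injective.\<close>
  then obtain J where J: "\<And>c. c \<in> T \<Longrightarrow> J c < b"
    "\<And>c. c \<in> T \<Longrightarrow> \<not> list_colorable M (\<lambda>v. R (J c) v - (\<lambda>i. c i v) ` {..<a})"
    by metis
  have disj: "A i v \<inter> A i' v = {}" if ii: "i < a" "i' < a" "i \<noteq> i'" and v: "v \<in> pverts M" for i i' v
  proof (rule ccontr)
    assume "A i v \<inter> A i' v \<noteq> {}"
    then obtain x where x: "x \<in> A i v" "x \<in> A i' v" by blast
    \<comment> \<open>Two distinct indices force \<open>a\<close> to be at least 2, so the list size
      exceeds \<open>k\<close>, as prescribing a colour requires.\<close>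
    have "1 < a" using ii by linarith
    then have big: "k < k + a - 1" by linarith
    \<comment> \<open>Prescribing \<open>x\<close> wherever it is available gives a tuple in which
      \<open>i\<close> and \<open>i'\<close> both use \<open>x\<close> at \<open>v\<close>, whereas
      a blocked tuple is injective at every vertex.\<close>
    have "\<forall>l<a. \<exists>c. c \<in> list_colorings M (A l) \<and> (x \<in> A l v \<longrightarrow> c v = x)"
    proof (intro allI impI)
      fix l assume l: "l < a"
      have "A l v \<noteq> {}"
        using A[OF l] v big by (fastforce simp: k_assignment_def)
      then obtain y where y: "y \<in> A l v" "x \<in> A l v \<longrightarrow> y = x" by blast
      then show "\<exists>c. c \<in> list_colorings M (A l) \<and> (x \<in> A l v \<longrightarrow> c v = x)"
        using list_coloring_with_prescribed_color[OF A[OF l] big v y(1)] by metis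
    qed
    then obtain c where c: "\<And>l. l < a \<Longrightarrow> c l \<in> list_colorings M (A l) \<and> (x \<in> A l v \<longrightarrow> c l v = x)"
      by metis
    let ?c = "restrict c {..<a}"
    have cT: "?c \<in> T" using c by (auto simp: T_def)
    have "inj_on (\<lambda>i. ?c i v) {..<a}"
      by (rule blocked_imp_residual[OF R[OF J(1)[OF cT]] J(2)[OF cT]]) (use v in blast)
    moreover have "?c i v = ?c i' v" using c ii x by simp
    ultimately show False
      using ii inj_onD[of "\<lambda>i. ?c i v" "{..<a}" i i'] by simp
  qed
  have "inj_on J T"
  proof (rule inj_onI)
    fix c d assume c: "c \<in> T" and d: "d \<in> T" and eq: "J c = J d"
    obtain C where C: "finite C" "card C = k - 1"
      "\<And>v. v \<in> pverts M \<Longrightarrow> (\<lambda>i. c i v) ` {..<a} = R (J c) v - C"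
      by (rule blocked_imp_residual[OF R[OF J(1)[OF c]] J(2)[OF c]]) blast
    obtain D where D: "card D = k - 1"
      "\<And>v. v \<in> pverts M \<Longrightarrow> R (J c) v - (\<lambda>i. d i v) ` {..<a} = D"
      "\<And>v. v \<in> pverts M \<Longrightarrow> (\<lambda>i. d i v) ` {..<a} = R (J c) v - D"
      unfolding eq by (rule blocked_imp_residual[OF R[OF J(1)[OF d]] J(2)[OF d]]) blast
    \<comment> \<open>Here \<open>a < k\<close> enters. Equal residual lists mean that
      \<open>c\<close> and \<open>d\<close> use the same set of colours at each vertex.\<close>
    have "C = D"
    proof (rule residual_unique[OF assms(2) C(1) _ T_proper[OF c] C(3)])
      show "card C = card D" using C(2) D(1) by simp
      show "D \<subseteq> R (J c) v" if "v \<in> pverts M" for v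
        using D(2)[OF that] by blast
    qed
    have "c i v = d i v" if i: "i < a" and v: "v \<in> pverts M" for i v
    proof -
      have "c i v \<in> (\<lambda>i. d i v) ` {..<a}"
        using C(3)[OF v] D(3)[OF v] \<open>C = D\<close> i by blast
      then obtain i' where i': "i' < a" "c i v = d i' v" by blast
      \<comment> \<open>The common colour lies in both \<open>A i v\<close> and
        \<open>A i' v\<close>, so disjointness recovers the index.\<close>
      then have "i' = i"
        using disj[of i i' v] T_A[OF c i v] T_A[OF d i'(1) v] i v by auto
      then show ?thesis using i' by simp
    qed
    then have "c i = d i" if "i < a" for i
      using c d that unfolding T_def list_colorings_def
      by (intro PiE_ext[of _ "pverts M" "A i"]) (auto dest: PiE_mem)
    then show "c = d"
      using c d unfolding T_def by (intro PiE_ext[of c "{..<a}"]) auto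
  qed
  then have "card T \<le> card {..<b}"
    using J(1) by (intro card_inj_on_le[of J]) auto
  moreover have "list_color_function M (k + a - 1) ^ a \<le> card T"
  proof -
    have "(\<Prod>i<a. list_color_function M (k + a - 1)) \<le> (\<Prod>i<a. card (list_colorings M (A i)))"
      using A by (intro prod_mono) (auto intro: list_color_function_le)
    then show ?thesis
      by (simp add: T_def card_PiE)
  qed
  ultimately show False
    using b by simp
qed

section \<open>The threshold for \<open>b\<close> and the conclusion\<close>

text \<open>By the upper bound, the value \<open>k + a\<close> is attained exactly when some
  \<open>(k + a - 1)\<close>-assignment is uncolourable; the construction and the counting argument
  meet at the same \<open>b\<close>.\<close>

lemma list_chromatic_number_product_eq_iff:
  assumes "1 \<le> a" "a < k"
  shows "list_chromatic_number (M \<box> complete_bipartite_graph a b) = k + a \<longleftrightarrow>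
    list_color_function M (k + a - 1) ^ a \<le> b"
proof -
  let ?H = "M \<box> complete_bipartite_graph a b"
  have "list_chromatic_number ?H = k + a \<longleftrightarrow> \<not> list_chromatic_number ?H \<le> k + a - 1"
    using list_chromatic_number_product_le[of a b] assms(1) by linarith
  also have "\<dots> \<longleftrightarrow> (\<exists>L. k_assignment (k + a - 1) ?H L \<and> \<not> list_colorable ?H L)"
    using list_chromatic_number_le_iff[of ?H] pair_graph_cartesian_product[OF pair_graph_M]
      pair_graph_complete_bipartite_graph by blast
  also have "\<dots> \<longleftrightarrow> list_color_function M (k + a - 1) ^ a \<le> b"
    using exists_uncolorable_product_assignment list_colorable_product_bipartite assms
    by (meson not_le)
  finally show ?thesis .
qed

end

theorem theorem1p8:
  fixes a :: nat and M :: "'a pair_pre_digraph"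
  assumes "a \<ge> 1"
    and "pair_graph M"
    and "pverts M \<noteq> {}"
    and "strongly_chromatic_choosable M"
    and "chromatic_number M \<ge> a + 1"
  shows "f_bip a M = enat (list_color_function M (list_chromatic_number M + a - 1) ^ a)"
proof -
  define k where "k = chromatic_number M"
  interpret pair_graph M by fact
  interpret strong_chromatic_choosable M k
    using assms by unfold_locales (simp_all add: k_def strongly_chromatic_choosable_def)
  let ?P = "list_color_function M (k + a - 1)"
  have "a < k" using assms(5) by (simp add: k_def)
  \<comment> \<open>\<open>f_bip\<close> admits only \<open>b \<ge> 1\<close>, so the threshold must
    be positive to be admissible itself.\<close>
  have "1 \<le> ?P ^ a"
    using list_color_function_pos[of "k + a - 1"] assms(1) by (simp add: Suc_le_eq)
  then show ?thesis
    unfolding f_bip_def list_chromatic_number_eq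
      list_chromatic_number_product_eq_iff[OF assms(1) \<open>a < k\<close>]
    by (intro antisym Inf_lower Inf_greatest) auto
qed

end
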